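(* Let $E$ be a complex Banach space. If $\mathcal{J}$ is a non-trivial closed ideal in $\mathcal{L}(E)$, then the set $$[\mathcal{J}]:=\{f\in\mathcal{H}_b(E,E): df(x)\in\mathcal{J}\ \text{for all}\ x\in E\}$$ is a proper closed ideal in $\mathcal{H}_b(E,E)$ containing $\mathcal{J}$. For the ideal $\mathcal{K}(E)$ of compact operators (with $[\mathcal{K}(E)]$ defined by the same formula), the inclusion $[\mathcal{K}(E)]\supset\mathcal{H}_k(E,E)$ holds. In particular, if $E=c_0$ or $E=\ell_p$ $(1\le p<\infty)$, then $[\mathcal{K}(E)]$ strictly contains $\mathcal{H}_k(E,E)$.
   Context: $\mathcal{H}_b(E,E)$ is the space of holomorphic (complex Fréchet differentiable) mappings $f:E\to E$ that are bounded on every bounded subset of $E$, with the topology of uniform convergence on bounded sets. $\mathcal{H}_k(E,E)$ is its subspace of mappings that map bounded sets into relatively compact sets. $\mathcal{L}(E)$ is the algebra of bounded linear operators on $E$ with the operator norm. $df(x)\in\mathcal{L}(E)$ is the Fréchet derivative of $f$ at $x$. An ideal in $\mathcal{H}_b(E,E)$ is a linear subspace $\mathcal{I}$ such that $f\circ g\circ h\in\mathcal{I}$ whenever $g\in\mathcal{I}$ and $f,h\in\mathcal{H}_b(E,E)$; it is proper if $\mathcal{I}\ne\mathcal{H}_b(E,E)$. An ideal $\mathcal{J}$ in $\mathcal{L}(E)$ (two-sided algebra ideal) is non-trivial if $\{0\}\subsetneq\mathcal{J}\subsetneq\mathcal{L}(E)$. $c_0$ and $\ell_p$ are the complex sequence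 spaces. *)

theory Defs
  imports "HOL-Analysis.Analysis"
begin

section \<open>Complex Banach spaces\<close>

class complex_normed_vector = real_normed_vector +
  fixes scaleC :: "complex \<Rightarrow> 'a \<Rightarrow> 'a"  (infixr \<open>*\<^sub>C\<close> 75)
  assumes scaleC_add_right: "c *\<^sub>C (x + y) = c *\<^sub>C x + c *\<^sub>C y"
    and scaleC_add_left: "(c + d) *\<^sub>C x = c *\<^sub>C x + d *\<^sub>C x"
    and scaleC_scaleC: "c *\<^sub>C d *\<^sub>C x = (c * d) *\<^sub>C x"
    and scaleC_of_real: "complex_of_real r *\<^sub>C x = r *\<^sub>R x"
    and norm_scaleC: "norm (c *\<^sub>C x) = cmod c * norm x"

class complex_banach = complex_normed_vector + complete_space

subclass (in complex_banach) banach ..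

lemma bounded_linear_scaleC: "bounded_linear (\<lambda>x::'a::complex_normed_vector. c *\<^sub>C x)"
proof (rule bounded_linear_intro[where K = "cmod c"])
  fix r :: real and x y :: 'a
  show "c *\<^sub>C (x + y) = c *\<^sub>C x + c *\<^sub>C y"
    by (rule scaleC_add_right)
  show "c *\<^sub>C (r *\<^sub>R x) = r *\<^sub>R (c *\<^sub>C x)"
    by (simp add: scaleC_of_real[symmetric] scaleC_scaleC mult.commute)
  show "norm (c *\<^sub>C x) \<le> norm x * cmod c"
    by (simp add: norm_scaleC mult.commute)
qed

instantiation complex :: complex_banach
begin

definition scaleC_complex :: "complex \<Rightarrow> complex \<Rightarrow> complex" where
  "scaleC_complex c x = c * x"

instance
  by standard (simp_all add: scaleC_complex_def algebra_simps norm_mult scaleR_conv_of_real)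

end

section \<open>Bounded operators\<close>

definition bounded_clinear :: "('a::complex_normed_vector \<Rightarrow> 'a) \<Rightarrow> bool" where
  "bounded_clinear T \<longleftrightarrow> bounded_linear T \<and> (\<forall>c x. T (c *\<^sub>C x) = c *\<^sub>C T x)"

text \<open>The type of bounded operators in the library consists of the real-linear ones and carries
  the operator norm; the algebra \<open>\<L>(E)\<close> is the normed subspace of complex-linear ones.\<close>

definition LE :: "('a::complex_banach \<Rightarrow>\<^sub>L 'a) set" where
  "LE = {T. bounded_clinear (blinfun_apply T)}"

definition compact_operators :: "('a::complex_banach \<Rightarrow>\<^sub>L 'a) set" where
  "compact_operators = {T \<in> LE. compact (closure (blinfun_apply T ` cball 0 1))}"

definition operator_ideal :: "('a::complex_banach \<Rightarrow>\<^sub>L 'a) set \<Rightarrow> bool" where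
  "operator_ideal J \<longleftrightarrow>
     J \<subseteq> LE \<and> 0 \<in> J \<and>
     (\<forall>S\<in>J. \<forall>T\<in>J. S + T \<in> J) \<and>
     (\<forall>c. \<forall>T\<in>J. Blinfun (\<lambda>x. c *\<^sub>C blinfun_apply T x) \<in> J) \<and>
     (\<forall>S\<in>LE. \<forall>T\<in>J. S o\<^sub>L T \<in> J \<and> T o\<^sub>L S \<in> J)"

definition nontrivial_closed_operator_ideal :: "('a::complex_banach \<Rightarrow>\<^sub>L 'a) set \<Rightarrow> bool" where
  "nontrivial_closed_operator_ideal J \<longleftrightarrow>
     operator_ideal J \<and> {0} \<subset> J \<and> J \<subset> LE \<and> closedin (top_of_set LE) J"

section \<open>Holomorphic mappings\<close>

definition holomorphic_map :: "('a::complex_banach \<Rightarrow> 'a) \<Rightarrow> bool" where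
  "holomorphic_map f \<longleftrightarrow> (\<forall>x. \<exists>D. bounded_clinear D \<and> (f has_derivative D) (at x))"

definition Hb :: "('a::complex_banach \<Rightarrow> 'a) set" where
  "Hb = {f. holomorphic_map f \<and> (\<forall>B. bounded B \<longrightarrow> bounded (f ` B))}"

definition Hk :: "('a::complex_banach \<Rightarrow> 'a) set" where
  "Hk = {f \<in> Hb. \<forall>B. bounded B \<longrightarrow> compact (closure (f ` B))}"

definition frechet_deriv :: "('a::complex_banach \<Rightarrow> 'a) \<Rightarrow> 'a \<Rightarrow> 'a \<Rightarrow>\<^sub>L 'a" where
  "frechet_deriv f x = Blinfun (frechet_derivative f (at x))"

text \<open>The topology of uniform convergence on bounded sets. Finite unions of bounded sets being
  bounded, the sets \<open>Hb_nhd f B \<epsilon>\<close> form a neighbourhood base at \<open>f\<close>.\<close>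

definition Hb_nhd :: "('a::complex_banach \<Rightarrow> 'a) \<Rightarrow> 'a set \<Rightarrow> real \<Rightarrow> ('a \<Rightarrow> 'a) set" where
  "Hb_nhd f B \<epsilon> = {g \<in> Hb. \<forall>x\<in>B. norm (g x - f x) < \<epsilon>}"

definition Hb_topology :: "('a::complex_banach \<Rightarrow> 'a) topology" where
  "Hb_topology =
     topology (\<lambda>U. U \<subseteq> Hb \<and> (\<forall>f\<in>U. \<exists>B \<epsilon>. bounded B \<and> \<epsilon> > 0 \<and> Hb_nhd f B \<epsilon> \<subseteq> U))"

lemma openin_Hb_topology:
  fixes U :: "('a::complex_banach \<Rightarrow> 'a) set"
  shows "openin Hb_topology U \<longleftrightarrow>
     U \<subseteq> Hb \<and> (\<forall>f\<in>U. \<exists>B \<epsilon>. bounded B \<and> \<epsilon> > 0 \<and> Hb_nhd f B \<epsilon> \<subseteq> U)"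
proof -
  let ?P = "\<lambda>U :: ('a \<Rightarrow> 'a) set. U \<subseteq> Hb \<and> (\<forall>f\<in>U. \<exists>B \<epsilon>. bounded B \<and> \<epsilon> > 0 \<and> Hb_nhd f B \<epsilon> \<subseteq> U)"
  have inter: "?P (S \<inter> T)" if S: "?P S" and T: "?P T" for S T :: "('a \<Rightarrow> 'a) set"
  proof (intro conjI ballI)
    show "S \<inter> T \<subseteq> Hb" using S by blast
    fix f assume "f \<in> S \<inter> T"
    then have "f \<in> S" "f \<in> T" by simp_all
    obtain B1 e1 where 1: "bounded B1" "e1 > 0" "Hb_nhd f B1 e1 \<subseteq> S"
      using bspec[OF conjunct2[OF S] \<open>f \<in> S\<close>] by (elim exE conjE)
    obtain B2 e2 where 2: "bounded B2" "e2 > 0" "Hb_nhd f B2 e2 \<subseteq> T"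
      using bspec[OF conjunct2[OF T] \<open>f \<in> T\<close>] by (elim exE conjE)
    have "Hb_nhd f (B1 \<union> B2) (min e1 e2) \<subseteq> Hb_nhd f B1 e1 \<inter> Hb_nhd f B2 e2"
      unfolding Hb_nhd_def by auto
    with 1 2 have "bounded (B1 \<union> B2)" "min e1 e2 > 0" "Hb_nhd f (B1 \<union> B2) (min e1 e2) \<subseteq> S \<inter> T"
      by auto
    then show "\<exists>B \<epsilon>. bounded B \<and> \<epsilon> > 0 \<and> Hb_nhd f B \<epsilon> \<subseteq> S \<inter> T"
      by (intro exI conjI)
  qed
  have union: "?P (\<Union>\<K>)" if K: "\<forall>K\<in>\<K>. ?P K" for \<K> :: "('a \<Rightarrow> 'a) set set"
  proof (intro conjI ballI)
    show "\<Union>\<K> \<subseteq> Hb" using K by blast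
    fix f assume "f \<in> \<Union>\<K>"
    then obtain U where U: "U \<in> \<K>" "f \<in> U" by (rule UnionE)
    then obtain B \<epsilon> where *: "bounded B" "\<epsilon> > 0" "Hb_nhd f B \<epsilon> \<subseteq> U"
      using bspec[OF K U(1)] by auto
    have "Hb_nhd f B \<epsilon> \<subseteq> \<Union>\<K>"
      using *(3) U(1) by (rule order_trans[OF _ Union_upper])
    with * show "\<exists>B \<epsilon>. bounded B \<and> \<epsilon> > 0 \<and> Hb_nhd f B \<epsilon> \<subseteq> \<Union>\<K>"
      by (intro exI conjI)
  qed
  have "istopology ?P"
    unfolding istopology_def
    using inter union by (intro conjI allI impI) simp_all
  then show ?thesis
    unfolding Hb_topology_def by (simp add: topology_inverse')
qed

lemma topspace_Hb_topology: "topspace Hb_topology = Hb"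
proof
  show "topspace Hb_topology \<subseteq> Hb"
    using openin_Hb_topology openin_topspace by blast
  have "openin Hb_topology Hb"
    unfolding openin_Hb_topology Hb_nhd_def by (auto intro!: exI[of _ "{}"] exI[of _ "1::real"])
  then show "Hb \<subseteq> topspace Hb_topology"
    by (rule openin_subset)
qed

definition Hb_ideal :: "('a::complex_banach \<Rightarrow> 'a) set \<Rightarrow> bool" where
  "Hb_ideal I \<longleftrightarrow>
     I \<subseteq> Hb \<and> (\<lambda>x. 0) \<in> I \<and>
     (\<forall>f\<in>I. \<forall>g\<in>I. (\<lambda>x. f x + g x) \<in> I) \<and>
     (\<forall>c. \<forall>f\<in>I. (\<lambda>x. c *\<^sub>C f x) \<in> I) \<and>
     (\<forall>g\<in>I. \<forall>f\<in>Hb. \<forall>h\<in>Hb. f \<circ> g \<circ> h \<in> I)"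

definition bracket :: "('a::complex_banach \<Rightarrow>\<^sub>L 'a) set \<Rightarrow> ('a \<Rightarrow> 'a) set" where
  "bracket J = {f \<in> Hb. \<forall>x. frechet_deriv f x \<in> J}"

section \<open>The classical sequence spaces\<close>

definition c0_set :: "(nat \<Rightarrow> complex) set" where
  "c0_set = {u. u \<longlonglongrightarrow> 0}"

definition c0_norm :: "(nat \<Rightarrow> complex) \<Rightarrow> real" where
  "c0_norm u = (SUP n. cmod (u n))"

definition lp_set :: "real \<Rightarrow> (nat \<Rightarrow> complex) set" where
  "lp_set p = {u. summable (\<lambda>n. cmod (u n) powr p)}"

definition lp_norm :: "real \<Rightarrow> (nat \<Rightarrow> complex) \<Rightarrow> real" where
  "lp_norm p u = (\<Sum>n. cmod (u n) powr p) powr (1 / p)"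

text \<open>A type cannot depend on the real number \<open>p\<close>, so \<open>E = \<ell>\<^sub>p\<close> is expressed by an isometric
  complex-linear bijection \<open>\<phi>\<close> from the whole type \<open>E\<close> onto the set \<open>S\<close> of sequences normed by \<open>N\<close>,
  with coordinatewise vector operations on \<open>S\<close>.\<close>

definition identifies_with ::
    "('a::complex_banach \<Rightarrow> nat \<Rightarrow> complex) \<Rightarrow> (nat \<Rightarrow> complex) set \<Rightarrow> ((nat \<Rightarrow> complex) \<Rightarrow> real) \<Rightarrow> bool"
  where
  "identifies_with \<phi> S N \<longleftrightarrow>
     bij_betw \<phi> UNIV S \<and>
     (\<forall>x y n. \<phi> (x + y) n = \<phi> x n + \<phi> y n) \<and>
     (\<forall>c x n. \<phi> (c *\<^sub>C x) n = c * \<phi> x n) \<and>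
     (\<forall>x. norm x = N (\<phi> x))"

definition is_c0 :: "'a::complex_banach itself \<Rightarrow> bool" where
  "is_c0 _ \<longleftrightarrow> (\<exists>\<phi> :: 'a \<Rightarrow> nat \<Rightarrow> complex. identifies_with \<phi> c0_set c0_norm)"

definition is_lp :: "real \<Rightarrow> 'a::complex_banach itself \<Rightarrow> bool" where
  "is_lp p _ \<longleftrightarrow> (\<exists>\<phi> :: 'a \<Rightarrow> nat \<Rightarrow> complex. identifies_with \<phi> (lp_set p) (lp_norm p))"

end

theory Submission
  imports Defs "HOL-Complex_Analysis.Cauchy_Integral_Formula"
begin

text \<open>The ideal property of \<open>[\<J>]\<close> is the chain rule, and \<open>[\<J>]\<close> is proper because the identity has
  derivative \<open>I \<notin> \<J>\<close>. It is closed because the Cauchy estimate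
  \<open>\<parallel>dh(x)\<parallel> \<le> sup {\<parallel>h(y)\<parallel> | \<parallel>y - x\<parallel> \<le> 1}\<close> makes \<open>f \<mapsto> df(x)\<close> continuous; a norming functional
  reduces this estimate to the scalar one. If \<open>f\<close> maps bounded sets to relatively compact sets, so do
  its difference quotients at \<open>x\<close>, and \<open>df(x)\<close> is their uniform limit on the unit ball. On \<open>c\<^sub>0\<close> and \<open>\<ell>\<^sub>p\<close> the
  mapping \<open>(x\<^sub>n) \<mapsto> (x\<^sub>n\<^sup>2)\<close> has the compact diagonal operators \<open>v \<mapsto> (2 x\<^sub>n v\<^sub>n)\<close> as derivatives, but
  it fixes the unit vectors, which have no convergent subsequence.\<close>

section \<open>Norming functionals\<close>

text \<open>Homogeneity is asked as an inequality for positive factors because infima inherit it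
  directly; \<open>sublinear_scale\<close> recovers the equality for every factor
  \<open>0 \<le> t\<close>.\<close>

definition sublinear :: "('a::real_vector \<Rightarrow> real) \<Rightarrow> bool" where
  "sublinear p \<longleftrightarrow>
     (\<forall>x y. p (x + y) \<le> p x + p y) \<and> (\<forall>t x. 0 < t \<longrightarrow> p (t *\<^sub>R x) \<le> t * p x)"

lemma sublinear_add: "sublinear p \<Longrightarrow> p (x + y) \<le> p x + p y"
  by (simp add: sublinear_def)

lemma sublinear_scale_le: "sublinear p \<Longrightarrow> 0 < t \<Longrightarrow> p (t *\<^sub>R x) \<le> t * p x"
  by (simp add: sublinear_def)

lemma sublinear_zero:
  assumes "sublinear p"
  shows "p 0 = 0"
  using sublinear_add[OF assms, of 0 0] sublinear_scale_le[OF assms, of "1/2" 0] by simp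

lemma sublinear_scale:
  assumes "sublinear p" "0 \<le> t"
  shows "p (t *\<^sub>R x) = t * p x"
proof (cases "t = 0")
  case False
  then have t: "0 < t" using assms by simp
  \<comment> \<open>The assumed inequality for the factor \<open>1/t\<close>, applied to
    \<open>t *\<^sub>R x\<close>, is the reverse inequality.\<close>
  have "p ((1/t) *\<^sub>R t *\<^sub>R x) \<le> (1/t) * p (t *\<^sub>R x)"
    using t by (intro sublinear_scale_le[OF assms(1)]) simp
  then have "t * p x \<le> p (t *\<^sub>R x)"
    using t by (simp add: field_simps)
  then show ?thesis
    using sublinear_scale_le[OF assms(1) t] by (simp add: antisym)
qed (simp add: sublinear_zero[OF assms(1)])

lemma sublinear_minus:
  assumes "sublinear p"
  shows "- p (- x) \<le> p x"
  using sublinear_add[OF assms, of x "- x"] by (simp add: sublinear_zero[OF assms])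

text \<open>The infimum defining \<open>q\<close> runs along the ray from \<open>x\<close> in
  direction \<open>a\<close>. Its entry at \<open>t = 0\<close> gives \<open>q x \<le> p x\<close>,
  and its entry at \<open>t = 1\<close> for \<open>x = - a\<close> is
  \<open>p 0 - p a = - p a\<close>.\<close>

lemma sublinear_lower:
  assumes p: "sublinear p"
  obtains q where "sublinear q" "\<And>x. q x \<le> p x" "q (- a) \<le> - p a"
proof -
  define q where "q x = (INF t\<in>{0..}. p (x + t *\<^sub>R a) - t * p a)" for x
  \<comment> \<open>A lower bound independent of \<open>t\<close>; without it the real
    \<open>INF\<close> would say nothing.\<close>
  have "- p (- x) \<le> p (x + t *\<^sub>R a) - t * p a" if "0 \<le> t" for x t
    using sublinear_add[OF p, of "x + t *\<^sub>R a" "- x"] sublinear_scale[OF p that, of a] by simp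
  then have bdd: "bdd_below ((\<lambda>t. p (x + t *\<^sub>R a) - t * p a) ` {0..})" for x
    by (intro bdd_belowI2[where m = "- p (- x)"]) simp
  have le: "q x \<le> p (x + t *\<^sub>R a) - t * p a" if "0 \<le> t" for x t
    unfolding q_def using that by (intro cINF_lower[OF bdd]) simp
  have ge: "m \<le> q x" if "\<And>t. 0 \<le> t \<Longrightarrow> m \<le> p (x + t *\<^sub>R a) - t * p a" for m x
    unfolding q_def using that by (intro cINF_greatest) auto
  have "sublinear q"
    unfolding sublinear_def
  proof (intro conjI allI impI)
    fix x y
    \<comment> \<open>The parameters \<open>s\<close> for \<open>x\<close> and \<open>t\<close> for
      \<open>y\<close> are matched by \<open>s + t\<close> for \<open>x + y\<close>; the two infima
      on the right are then taken one after the other.\<close>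
    have "q (x + y) - (p (x + s *\<^sub>R a) - s * p a) \<le> p (y + t *\<^sub>R a) - t * p a"
      if "0 \<le> s" "0 \<le> t" for s t
      using le[of "s + t" "x + y"] sublinear_add[OF p, of "x + s *\<^sub>R a" "y + t *\<^sub>R a"] that
      by (simp add: algebra_simps)
    then have "q (x + y) - (p (x + s *\<^sub>R a) - s * p a) \<le> q y" if "0 \<le> s" for s
      using that by (intro ge)
    then have "q (x + y) - q y \<le> q x"
      by (intro ge) (simp add: algebra_simps)
    then show "q (x + y) \<le> q x + q y" by simp
  next
    fix s :: real and x assume s: "0 < s"
    have "q (s *\<^sub>R x) / s \<le> q x"
    proof (rule ge)
      fix t :: real assume t: "0 \<le> t"
      \<comment> \<open>The parameter \<open>s * t\<close> for \<open>s *\<^sub>R x\<close>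
        corresponds to \<open>t\<close> for \<open>x\<close>.\<close>
      have "q (s *\<^sub>R x) \<le> p (s *\<^sub>R (x + t *\<^sub>R a)) - s * t * p a"
        using le[of "s * t" "s *\<^sub>R x"] s t by (simp add: algebra_simps)
      also have "\<dots> = s * (p (x + t *\<^sub>R a) - t * p a)"
        using sublinear_scale[OF p, of s "x + t *\<^sub>R a"] s by (simp add: right_diff_distrib)
      finally show "q (s *\<^sub>R x) / s \<le> p (x + t *\<^sub>R a) - t * p a"
        using s by (simp add: field_simps)
    qed
    then show "q (s *\<^sub>R x) \<le> s * q x"
      using s by (simp add: field_simps)
  qed
  moreover have "q x \<le> p x" for x using le[of 0 x] by simp
  moreover have "q (- a) \<le> - p a"
    using le[of 1 "- a"] by (simp add: sublinear_zero[OF p])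
  ultimately show thesis by (rule that)
qed

text \<open>The right-hand side of subadditivity involves two members of \<open>C\<close>, one at
  \<open>x\<close> and one at \<open>y\<close>; in a chain the smaller of them can serve at both
  points.\<close>

lemma sublinear_chain_INF:
  assumes "C \<noteq> {}" and sub: "\<And>p. p \<in> C \<Longrightarrow> sublinear p"
    and chain: "\<And>p q. p \<in> C \<Longrightarrow> q \<in> C \<Longrightarrow> p \<le> q \<or> q \<le> p"
    and bdd: "\<And>x. bdd_below ((\<lambda>p. p x) ` C)"
  shows "sublinear (\<lambda>x. INF p\<in>C. p x)"
proof -
  define q where "q x = (INF p\<in>C. p x)" for x
  have le: "q x \<le> p x" if "p \<in> C" for x p
    unfolding q_def using that by (rule cINF_lower[OF bdd])
  have ge: "m \<le> q x" if "\<And>p. p \<in> C \<Longrightarrow> m \<le> p x" for m x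
    unfolding q_def using that by (rule cINF_greatest[OF assms(1)])
  have "sublinear q"
    unfolding sublinear_def
  proof (intro conjI allI impI)
    fix x y
    have "q (x + y) - p1 x \<le> p2 y" if "p1 \<in> C" "p2 \<in> C" for p1 p2
      using chain[OF that]
    proof
      assume "p1 \<le> p2"
      then show ?thesis
        using le[OF that(1), of "x + y"] sublinear_add[OF sub[OF that(1)], of x y]
          le_funD[of p1 p2 y] by linarith
    next
      assume "p2 \<le> p1"
      then show ?thesis
        using le[OF that(2), of "x + y"] sublinear_add[OF sub[OF that(2)], of x y]
          le_funD[of p2 p1 x] by linarith
    qed
    then have "q (x + y) - p1 x \<le> q y" if "p1 \<in> C" for p1
      using that by (intro ge)
    then have "q (x + y) - q y \<le> q x"
      by (intro ge) (simp add: algebra_simps)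
    then show "q (x + y) \<le> q x + q y" by simp
  next
    fix s :: real and x assume s: "0 < s"
    have "q (s *\<^sub>R x) / s \<le> q x"
    proof (rule ge)
      fix p assume p: "p \<in> C"
      show "q (s *\<^sub>R x) / s \<le> p x"
        using le[OF p, of "s *\<^sub>R x"] sublinear_scale_le[OF sub[OF p] s, of x] s
        by (simp add: field_simps)
    qed
    then show "q (s *\<^sub>R x) \<le> s * q x"
      using s by (simp add: field_simps)
  qed
  then show ?thesis by (simp add: q_def[abs_def])
qed

text \<open>A sublinear functional that is minimal for the pointwise order is linear, by
  \<open>sublinear_lower\<close>; this replaces the extension argument for Hahn--Banach.\<close>

lemma ex_minimal_sublinear:
  assumes p: "sublinear p"
  obtains m where "sublinear m" "m \<le> p" "\<And>q. sublinear q \<Longrightarrow> q \<le> m \<Longrightarrow> q = m"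
proof -
  define A where "A = {q. sublinear q \<and> q \<le> p}"
  have "\<exists>m\<in>A. \<forall>a\<in>A. a \<le> m \<longrightarrow> a = m"
  \<comment> \<open>Zorn's lemma for the reversed order: upper bounds of chains are pointwise
    infima, and maximal elements are minimal functionals.\<close>
  proof (rule predicate_Zorn[where P = "\<lambda>a b. b \<le> a"])
    show "partial_order_on A (relation_of (\<lambda>a b. b \<le> a) A)"
      by (auto simp: partial_order_on_def preorder_on_def refl_on_def trans_def antisym_def
          relation_of_def)
  next
    fix C assume "C \<in> Chains (relation_of (\<lambda>a b. b \<le> a) A)"
    then have C: "C \<subseteq> A" "\<And>a b. a \<in> C \<Longrightarrow> b \<in> C \<Longrightarrow> a \<le> b \<or> b \<le> a"
      by (auto simp: Chains_def relation_of_def)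
    show "\<exists>u\<in>A. \<forall>a\<in>C. u \<le> a"
    proof (cases "C = {}")
      case True
      then show ?thesis using p by (auto simp: A_def)
    next
      case False
      define q where "q x = (INF c\<in>C. c x)" for x
      \<comment> \<open>A bound common to the whole chain, from
        \<open>- p (- x) \<le> - c (- x) \<le> c x\<close>.\<close>
      have "- p (- x) \<le> c x" if "c \<in> C" for c x
        using sublinear_minus[of c x] le_funD[of c p "- x"] that C(1) by (force simp: A_def)
      then have bdd: "bdd_below ((\<lambda>c. c x) ` C)" for x
        by (intro bdd_belowI2[where m = "- p (- x)"])
      have "sublinear q"
        unfolding q_def[abs_def] using False C bdd
        by (intro sublinear_chain_INF) (auto simp: A_def)
      moreover have low: "q \<le> c" if "c \<in> C" for c
        unfolding q_def[abs_def] le_fun_def using that by (auto intro: cINF_lower[OF bdd])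
      moreover obtain c where "c \<in> C" using False by blast
      ultimately have "q \<in> A" using C(1) order_trans[OF low, of c p] by (auto simp: A_def)
      then show ?thesis using low by blast
    qed
  qed
  then obtain m where m: "m \<in> A" and min: "\<And>a. a \<in> A \<Longrightarrow> a \<le> m \<Longrightarrow> a = m"
    by blast
  show thesis
  proof
    show "sublinear m" "m \<le> p" using m by (auto simp: A_def)
    show "q = m" if "sublinear q" "q \<le> m" for q
      using min[of q] that m by (auto simp: A_def)
  qed
qed

text \<open>Minimality forces the functional \<open>q\<close> of \<open>sublinear_lower\<close> to
  be \<open>m\<close> itself, so \<open>m\<close> is odd. For an odd functional, subadditivity at
  \<open>x, y\<close> and at \<open>- x, - y\<close> gives both inequalities of additivity.\<close>

lemma minimal_sublinear_imp_linear:
  assumes m: "sublinear m" and min: "\<And>q. sublinear q \<Longrightarrow> q \<le> m \<Longrightarrow> q = m"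
  shows "linear m"
proof -
  have neg: "m (- a) = - m a" for a
  proof -
    obtain q where "sublinear q" "\<And>x. q x \<le> m x" "q (- a) \<le> - m a"
      by (rule sublinear_lower[OF m, of a]) blast
    then have "m (- a) \<le> - m a" using min[of q] by (auto simp: le_fun_def)
    then show ?thesis using sublinear_minus[OF m, of a] by linarith
  qed
  show ?thesis
  proof (rule linearI)
    fix x y
    show "m (x + y) = m x + m y"
      using sublinear_add[OF m, of x y] sublinear_add[OF m, of "- x" "- y"] neg[of x] neg[of y]
        neg[of "x + y"] by simp
  next
    fix r x
    show "m (r *\<^sub>R x) = r *\<^sub>R m x"
      using sublinear_scale[OF m, of r x] sublinear_scale[OF m, of "- r" x] neg[of "r *\<^sub>R x"]
      by (cases "0 \<le> r") simp_all
  qed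
qed

text \<open>The norm is first lowered to some \<open>p\<close> with
  \<open>p (- a) \<le> - norm a\<close>. Every linear \<open>m\<close> below \<open>p\<close> then
  satisfies \<open>- m a = m (- a) \<le> - norm a\<close>, which forces its value at
  \<open>a\<close>.\<close>

lemma ex_norming_functional:
  fixes a :: "'a::real_normed_vector"
  obtains m :: "'a \<Rightarrow> real" where "linear m" "\<And>x. m x \<le> norm x" "m a = norm a"
proof -
  have "sublinear (norm :: 'a \<Rightarrow> real)"
    by (simp add: sublinear_def norm_triangle_ineq)
  then obtain p where p: "sublinear p" "\<And>x. p x \<le> norm x" "p (- a) \<le> - norm a"
    by (rule sublinear_lower[where a = a]) blast
  obtain m where m: "sublinear m" "m \<le> p" "\<And>q. sublinear q \<Longrightarrow> q \<le> m \<Longrightarrow> q = m"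
    by (rule ex_minimal_sublinear[OF p(1)]) blast
  have lin: "linear m" using minimal_sublinear_imp_linear m by blast
  have le: "m x \<le> norm x" for x using le_funD[OF m(2)] p(2) order_trans by blast
  have "- m a \<le> - norm a"
    using le_funD[OF m(2), of "- a"] p(3) linear_neg[OF lin, of a] by simp
  then have "m a = norm a" using le[of a] by simp
  with lin le show thesis by (rule that)
qed

lemma scaleC_one [simp]: "1 *\<^sub>C (x::'a::complex_normed_vector) = x"
  using scaleC_of_real[of 1 x] by simp

text \<open>The real norming functional \<open>m\<close> is complexified to
  \<open>m x - i m (i x)\<close>, the complex-linear functional with real part
  \<open>m\<close>.\<close>

lemma ex_complex_norming_functional:
  fixes a :: "'a::complex_normed_vector"
  obtains \<psi> :: "'a \<Rightarrow> complex"
  where "bounded_linear \<psi>" "\<And>c x. \<psi> (c *\<^sub>C x) = c * \<psi> x" "\<And>x. cmod (\<psi> x) \<le> norm x"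
    "Re (\<psi> a) = norm a"
proof -
  obtain m :: "'a \<Rightarrow> real" where m: "linear m" "\<And>x. m x \<le> norm x" "m a = norm a"
    using ex_norming_functional[of a] by blast
  define \<psi> where "\<psi> x = Complex (m x) (- m (\<i> *\<^sub>C x))" for x
  have scaleC_split: "c *\<^sub>C x = Re c *\<^sub>R x + Im c *\<^sub>R (\<i> *\<^sub>C x)" for c and x :: 'a
    by (subst complex_eq)
      (simp add: scaleC_add_left scaleC_of_real[symmetric] scaleC_scaleC mult.commute)
  have ii: "\<i> *\<^sub>C \<i> *\<^sub>C x = - x" for x :: 'a
    using scaleC_of_real[of "-1" x] by (simp add: scaleC_scaleC)
  have iR: "\<i> *\<^sub>C r *\<^sub>R x = r *\<^sub>R \<i> *\<^sub>C x" for r and x :: 'a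
    by (simp add: scaleC_of_real[symmetric] scaleC_scaleC mult.commute)
  have C: "\<psi> (c *\<^sub>C x) = c * \<psi> x" for c x
    by (simp add: \<psi>_def complex_eq_iff scaleC_split[of c] scaleC_add_right ii iR linear_add[OF m(1)]
        linear_scale[OF m(1)] linear_neg[OF m(1)] linear_diff[OF m(1)])
  have bound: "cmod (\<psi> x) \<le> norm x" for x
  proof (cases "\<psi> x = 0")
    case False
    \<comment> \<open>The unimodular factor that rotates \<open>\<psi> x\<close> to its modulus, so
      that the bound on the real part \<open>m\<close> becomes one on the modulus.\<close>
    define c where "c = cnj (\<psi> x) / cmod (\<psi> x)"
    have "cmod c = 1" using False by (simp add: c_def norm_divide)
    have "c * \<psi> x = cmod (\<psi> x)"
      using False by (simp add: c_def complex_norm_square[symmetric] power2_eq_square mult.commute)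
    then have "cmod (\<psi> x) = Re (\<psi> (c *\<^sub>C x))" by (simp add: C)
    also have "\<dots> = m (c *\<^sub>C x)" by (simp add: \<psi>_def)
    also have "\<dots> \<le> norm x"
      using m(2)[of "c *\<^sub>C x"] \<open>cmod c = 1\<close> by (simp add: norm_scaleC)
    finally show ?thesis .
  qed simp
  have "bounded_linear \<psi>"
  proof (rule bounded_linear_intro[where K = 1])
    show "\<psi> (x + y) = \<psi> x + \<psi> y" for x y
      by (simp add: \<psi>_def complex_eq_iff scaleC_add_right linear_add[OF m(1)])
    show "\<psi> (r *\<^sub>R x) = r *\<^sub>R \<psi> x" for r x
      by (simp add: \<psi>_def complex_eq_iff iR linear_scale[OF m(1)])
  qed (simp add: bound)
  moreover have "Re (\<psi> a) = norm a" by (simp add: \<psi>_def m)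
  ultimately show thesis using C bound by (intro that)
qed

section \<open>Holomorphic mappings\<close>

lemma bounded_clinear_comp:
  "bounded_clinear S \<Longrightarrow> bounded_clinear T \<Longrightarrow> bounded_clinear (\<lambda>x. S (T x))"
  by (simp add: bounded_clinear_def bounded_linear_compose)

lemma bounded_clinear_scaleC:
  "bounded_clinear T \<Longrightarrow> bounded_clinear (\<lambda>x. c *\<^sub>C T x)"
  by (simp add: bounded_clinear_def scaleC_scaleC mult.commute
      bounded_linear_compose[OF bounded_linear_scaleC])

lemma bounded_clinear_add:
  "bounded_clinear S \<Longrightarrow> bounded_clinear T \<Longrightarrow> bounded_clinear (\<lambda>x. S x + T x)"
  by (simp add: bounded_clinear_def bounded_linear_add scaleC_add_right)

text \<open>By uniqueness of the derivative, exhibiting any derivative \<open>D\<close> computes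
  \<open>frechet_deriv\<close>.\<close>

lemma frechet_deriv_eq:
  assumes "(f has_derivative D) (at x)"
  shows "frechet_deriv f x = Blinfun D" "blinfun_apply (frechet_deriv f x) = D"
  using frechet_derivative_at[OF assms] has_derivative_bounded_linear[OF assms]
  by (simp_all add: frechet_deriv_def bounded_linear_Blinfun_apply)

lemma holomorphic_map_has_derivative:
  assumes "holomorphic_map f"
  shows "(f has_derivative blinfun_apply (frechet_deriv f x)) (at x)"
  using assms frechet_deriv_eq(2) unfolding holomorphic_map_def by metis

lemma frechet_deriv_in_LE:
  assumes "holomorphic_map f"
  shows "frechet_deriv f x \<in> LE"
  using assms frechet_deriv_eq(2) unfolding holomorphic_map_def LE_def by fastforce

lemma bounded_clinear_frechet_deriv:
  "holomorphic_map f \<Longrightarrow> bounded_clinear (blinfun_apply (frechet_deriv f x))"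
  using frechet_deriv_in_LE by (auto simp: LE_def)

lemma Hb_I:
  assumes "\<And>x. (f has_derivative D x) (at x)" "\<And>x. bounded_clinear (D x)"
    and "\<And>B. bounded B \<Longrightarrow> bounded (f ` B)"
  shows "f \<in> Hb"
  using assms unfolding Hb_def holomorphic_map_def by blast

lemma bounded_image_Hb: "f \<in> Hb \<Longrightarrow> bounded B \<Longrightarrow> bounded (f ` B)"
  by (simp add: Hb_def)

lemma Hb_has_derivative:
  "f \<in> Hb \<Longrightarrow> (f has_derivative blinfun_apply (frechet_deriv f x)) (at x)"
  by (simp add: Hb_def holomorphic_map_has_derivative)

lemma frechet_deriv_Hb_in_LE: "f \<in> Hb \<Longrightarrow> frechet_deriv f x \<in> LE"
  by (simp add: Hb_def frechet_deriv_in_LE)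

lemma bounded_clinear_frechet_deriv_Hb:
  "f \<in> Hb \<Longrightarrow> bounded_clinear (blinfun_apply (frechet_deriv f x))"
  using frechet_deriv_Hb_in_LE by (auto simp: LE_def)

lemma Hb_add:
  assumes "f \<in> Hb" "g \<in> Hb"
  shows "(\<lambda>x. f x + g x) \<in> Hb"
    "frechet_deriv (\<lambda>x. f x + g x) x = frechet_deriv f x + frechet_deriv g x"
proof -
  have d: "((\<lambda>x. f x + g x) has_derivative
      (\<lambda>v. blinfun_apply (frechet_deriv f x) v + blinfun_apply (frechet_deriv g x) v)) (at x)" for x
    by (intro has_derivative_add Hb_has_derivative assms)
  show "(\<lambda>x. f x + g x) \<in> Hb"
    using d
    by (rule Hb_I) (simp_all add: bounded_clinear_add bounded_clinear_frechet_deriv_Hb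
        bounded_plus_comp bounded_image_Hb assms)
  show "frechet_deriv (\<lambda>x. f x + g x) x = frechet_deriv f x + frechet_deriv g x"
    by (rule blinfun_eqI) (simp add: frechet_deriv_eq(2)[OF d] plus_blinfun.rep_eq)
qed

lemma Hb_scaleC:
  assumes "f \<in> Hb"
  shows "(\<lambda>x. c *\<^sub>C f x) \<in> Hb"
    "frechet_deriv (\<lambda>x. c *\<^sub>C f x) x = Blinfun (\<lambda>v. c *\<^sub>C blinfun_apply (frechet_deriv f x) v)"
proof -
  have d: "((\<lambda>x. c *\<^sub>C f x) has_derivative
      (\<lambda>v. c *\<^sub>C blinfun_apply (frechet_deriv f x) v)) (at x)" for x
    by (rule bounded_linear.has_derivative[OF bounded_linear_scaleC Hb_has_derivative[OF assms]])
  have "bounded ((\<lambda>x. c *\<^sub>C f x) ` B)" if "bounded B" for B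
    using bounded_linear_image[OF bounded_image_Hb[OF assms that] bounded_linear_scaleC, of c]
    by (simp add: image_image)
  then show "(\<lambda>x. c *\<^sub>C f x) \<in> Hb"
    by (intro Hb_I[OF d]) (simp_all add: bounded_clinear_scaleC bounded_clinear_frechet_deriv_Hb assms)
  show "frechet_deriv (\<lambda>x. c *\<^sub>C f x) x = Blinfun (\<lambda>v. c *\<^sub>C blinfun_apply (frechet_deriv f x) v)"
    by (rule frechet_deriv_eq(1)[OF d])
qed

lemma Hb_comp:
  assumes "f \<in> Hb" "g \<in> Hb"
  shows "f \<circ> g \<in> Hb"
    "frechet_deriv (f \<circ> g) x = frechet_deriv f (g x) o\<^sub>L frechet_deriv g x"
proof -
  have d: "(f \<circ> g has_derivative
      (\<lambda>v. blinfun_apply (frechet_deriv f (g x)) (blinfun_apply (frechet_deriv g x) v))) (at x)" for x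
    using diff_chain_at[OF Hb_has_derivative[OF assms(2)] Hb_has_derivative[OF assms(1)]]
    by (simp add: comp_def)
  have "bounded ((f \<circ> g) ` B)" if "bounded B" for B
    using bounded_image_Hb assms that by (metis image_comp)
  then show "f \<circ> g \<in> Hb"
    by (intro Hb_I[OF d]) (simp_all add: bounded_clinear_comp bounded_clinear_frechet_deriv_Hb assms)
  show "frechet_deriv (f \<circ> g) x = frechet_deriv f (g x) o\<^sub>L frechet_deriv g x"
    by (rule blinfun_eqI) (simp add: frechet_deriv_eq(2)[OF d])
qed

lemma LE_in_Hb:
  assumes "T \<in> LE"
  shows "blinfun_apply T \<in> Hb" "frechet_deriv (blinfun_apply T) x = T"
proof -
  have d: "(blinfun_apply T has_derivative blinfun_apply T) (at x)" for x
    by (rule bounded_linear_imp_has_derivative[OF blinfun.bounded_linear_right])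
  show "blinfun_apply T \<in> Hb"
    using assms by (intro Hb_I[OF d] bounded_linear_image blinfun.bounded_linear_right)
      (simp_all add: LE_def)
  show "frechet_deriv (blinfun_apply T) x = T"
    by (rule blinfun_eqI) (simp add: frechet_deriv_eq(2)[OF d])
qed

text \<open>The Cauchy estimate for radius 1. For a unit vector \<open>v\<close> and a functional
  \<open>\<psi>\<close> norming \<open>?D v\<close>, the function \<open>F\<close> on the complex
  line through \<open>x\<close> in direction \<open>v\<close> is entire, has derivative
  \<open>\<psi> (?D v)\<close> at \<open>0\<close>, and is bounded by \<open>M\<close> on the unit
  circle.\<close>

lemma norm_derivative_le:
  fixes h :: "'a::complex_banach \<Rightarrow> 'a"
  assumes hol: "holomorphic_map h" and le: "\<And>y. y \<in> cball x 1 \<Longrightarrow> norm (h y) \<le> M"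
  shows "norm (frechet_deriv h x) \<le> M"
proof -
  let ?D = "blinfun_apply (frechet_deriv h x)"
  have M: "0 \<le> M" using le[of x] norm_ge_zero[of "h x"] by (simp del: norm_ge_zero)
  have unit: "norm (?D v) \<le> M" if v: "norm v = 1" for v
  proof -
    obtain \<psi> :: "'a \<Rightarrow> complex" where \<psi>: "bounded_linear \<psi>" "\<And>c x. \<psi> (c *\<^sub>C x) = c * \<psi> x"
      "\<And>x. cmod (\<psi> x) \<le> norm x" "Re (\<psi> (?D v)) = norm (?D v)"
      using ex_complex_norming_functional[of "?D v"] by blast
    define F where "F z = \<psi> (h (x + z *\<^sub>C v))" for z
    have dline: "((\<lambda>z. x + z *\<^sub>C v) has_derivative (\<lambda>w. w *\<^sub>C v)) (at z)" for z :: complex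
    proof -
      have "bounded_linear (\<lambda>w::complex. w *\<^sub>C v)"
      proof (rule bounded_linear_intro[where K = "norm v"])
        show "(r *\<^sub>R w) *\<^sub>C v = r *\<^sub>R w *\<^sub>C v" for r w
          by (simp add: scaleC_of_real[symmetric] scaleC_scaleC scaleC_complex_def)
      qed (simp_all add: scaleC_add_left norm_scaleC)
      then show ?thesis
        using has_derivative_add[OF has_derivative_const[of x] bounded_linear_imp_has_derivative]
        by fastforce
    qed
    have dF: "(F has_field_derivative \<psi> (blinfun_apply (frechet_deriv h (x + z *\<^sub>C v)) v)) (at z)" for z
    proof -
      have "((\<lambda>z. \<psi> (h (x + z *\<^sub>C v))) has_derivative
          (\<lambda>w. \<psi> (blinfun_apply (frechet_deriv h (x + z *\<^sub>C v)) (w *\<^sub>C v)))) (at z)"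
        by (intro bounded_linear.has_derivative[OF \<psi>(1)] has_derivative_compose[OF dline]
            holomorphic_map_has_derivative hol)
      \<comment> \<open>Complex linearity of the derivative turns the real derivative of
        \<open>F\<close> into multiplication by a complex number.\<close>
      moreover have "blinfun_apply (frechet_deriv h y) (w *\<^sub>C v)
          = w *\<^sub>C blinfun_apply (frechet_deriv h y) v" for y w
        using bounded_clinear_frechet_deriv[OF hol] by (simp add: bounded_clinear_def)
      ultimately show ?thesis
        by (simp add: F_def[abs_def] has_field_derivative_def \<psi>(2) mult_commute_abs)
    qed
    have hF: "F holomorphic_on S" for S
      using dF field_differentiable_at_within
      unfolding holomorphic_on_def field_differentiable_def by blast
    have "cmod ((deriv ^^ 1) F 0) \<le> fact 1 * M / 1 ^ 1"
    proof (rule Cauchy_inequality)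
      show "continuous_on (cball 0 1) F" by (rule holomorphic_on_imp_continuous_on[OF hF])
      fix z :: complex assume "cmod (0 - z) = 1"
      then have "norm (h (x + z *\<^sub>C v)) \<le> M"
        using v by (intro le) (simp add: dist_norm norm_scaleC)
      then show "cmod (F z) \<le> M" using \<psi>(3) order_trans unfolding F_def by blast
    qed (simp_all add: hF)
    moreover have "deriv F 0 = \<psi> (?D v)"
      using DERIV_imp_deriv[OF dF[of 0]] scaleC_of_real[of 0 v] by simp
    ultimately have "cmod (\<psi> (?D v)) \<le> M" by simp
    then show ?thesis
      using \<psi>(4) complex_Re_le_cmod[of "\<psi> (?D v)"] by linarith
  qed
  show ?thesis
  proof (rule norm_blinfun_bound[OF M])
    fix v
    show "norm (?D v) \<le> M * norm v"
    proof (cases "v = 0")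
      case False
      have "norm (?D (v /\<^sub>R norm v)) \<le> M"
        using False by (intro unit) simp
      then show ?thesis
        using False by (simp add: blinfun.scaleR_right field_simps)
    qed (simp add: blinfun.zero_right)
  qed
qed

section \<open>The ideal of mappings with derivatives in an operator ideal\<close>

lemma id_in_LE: "id_blinfun \<in> LE"
  using bounded_linear_ident by (simp add: LE_def bounded_clinear_def id_def)

lemma id_notin_proper_ideal:
  assumes "operator_ideal J" "J \<noteq> LE"
  shows "id_blinfun \<notin> J"
proof
  assume "id_blinfun \<in> J"
  have "T \<in> J" if "T \<in> LE" for T
  proof -
    have "T o\<^sub>L id_blinfun \<in> J"
      using assms(1) that \<open>id_blinfun \<in> J\<close> unfolding operator_ideal_def by blast
    moreover have "T o\<^sub>L id_blinfun = T" by (rule blinfun_eqI) simp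
    ultimately show ?thesis by simp
  qed
  with assms show False unfolding operator_ideal_def by blast
qed

text \<open>A bounded operator is its own derivative at every point.\<close>

lemma operator_ideal_image_subset_bracket:
  assumes "operator_ideal J"
  shows "blinfun_apply ` J \<subseteq> bracket J"
  using assms LE_in_Hb by (auto simp: operator_ideal_def bracket_def subset_iff)

text \<open>By the chain rule, the derivative of \<open>f \<circ> g \<circ> h\<close> is a
  derivative of \<open>g\<close> between two factors from \<open>LE\<close>, which \<open>J\<close>
  absorbs. The linear structure passes through differentiation.\<close>

lemma Hb_ideal_bracket:
  assumes J: "operator_ideal J"
  shows "Hb_ideal (bracket J)"
proof -
  have "blinfun_apply 0 \<in> bracket J"
    using operator_ideal_image_subset_bracket[OF J] J by (auto simp: operator_ideal_def)
  then have "(\<lambda>x. 0) \<in> bracket J" by (simp add: zero_blinfun.rep_eq)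
  moreover have "f \<circ> g \<circ> h \<in> bracket J" if g: "g \<in> bracket J" and fh: "f \<in> Hb" "h \<in> Hb" for f g h
  proof -
    have gH: "g \<in> Hb" using g by (simp add: bracket_def)
    have "frechet_deriv (f \<circ> g \<circ> h) x =
        (frechet_deriv f (g (h x)) o\<^sub>L frechet_deriv g (h x)) o\<^sub>L frechet_deriv h x" for x
      by (simp add: Hb_comp gH fh)
    moreover have "\<dots> x \<in> J" for x
      using J g frechet_deriv_Hb_in_LE[OF fh(1)] frechet_deriv_Hb_in_LE[OF fh(2)]
      unfolding operator_ideal_def bracket_def by blast
    ultimately show ?thesis
      by (simp add: bracket_def Hb_comp gH fh)
  qed
  ultimately show ?thesis
    using J unfolding Hb_ideal_def operator_ideal_def bracket_def
    by (auto simp: Hb_add Hb_scaleC)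
qed

lemma bracket_neq_Hb:
  fixes J :: "('a::complex_banach \<Rightarrow>\<^sub>L 'a) set"
  assumes "operator_ideal J" "J \<noteq> LE"
  shows "bracket J \<noteq> Hb"
proof -
  have "frechet_deriv (blinfun_apply id_blinfun) 0 \<notin> J"
    unfolding LE_in_Hb(2)[OF id_in_LE] by (rule id_notin_proper_ideal[OF assms])
  then have "blinfun_apply id_blinfun \<in> Hb - bracket J"
    using LE_in_Hb(1)[OF id_in_LE] unfolding bracket_def by blast
  then show ?thesis by blast
qed

text \<open>The complement is open: if the derivative of \<open>f\<close> at \<open>x\<close> lies
  outside \<open>J\<close>, a ball around it within \<open>LE\<close> misses \<open>J\<close>. By
  the Cauchy estimate for \<open>g - f\<close>, closeness of \<open>g\<close> to \<open>f\<close> on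
  the unit ball around \<open>x\<close> keeps the derivative of \<open>g\<close> in that
  ball.\<close>

lemma closedin_bracket:
  fixes J :: "('a::complex_banach \<Rightarrow>\<^sub>L 'a) set"
  assumes "closedin (top_of_set LE) J"
  shows "closedin Hb_topology (bracket J)"
proof -
  have "\<exists>B \<epsilon>. bounded B \<and> \<epsilon> > 0 \<and> Hb_nhd f B \<epsilon> \<subseteq> Hb - bracket J"
    if f: "f \<in> Hb - bracket J" for f
  proof -
    obtain x where x: "frechet_deriv f x \<notin> J" using f by (auto simp: bracket_def)
    have "openin (top_of_set LE) (LE - J)" using assms by (simp add: closedin_def)
    moreover have "frechet_deriv f x \<in> LE - J" using f x frechet_deriv_Hb_in_LE by auto
    ultimately obtain e where e: "e > 0" "ball (frechet_deriv f x) e \<inter> LE \<subseteq> LE - J"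
      unfolding openin_contains_ball by blast
    have "g \<in> Hb - bracket J" if g: "g \<in> Hb_nhd f (cball x 1) (e/2)" for g
    proof -
      have gH: "g \<in> Hb" and less: "\<And>y. y \<in> cball x 1 \<Longrightarrow> norm (g y - f y) < e/2"
        using g by (auto simp: Hb_nhd_def)
      \<comment> \<open>The difference is written with the factor \<open>-1\<close> so that the
        closure rules \<open>Hb_add\<close> and \<open>Hb_scaleC\<close> apply.\<close>
      let ?h = "\<lambda>y. g y + (-1) *\<^sub>C f y"
      have m1: "(-1) *\<^sub>C y = - y" for y :: 'a using scaleC_of_real[of "-1" y] by simp
      have fH: "(\<lambda>y. (-1) *\<^sub>C f y) \<in> Hb" using f Hb_scaleC by blast
      have "norm (frechet_deriv ?h x) \<le> e/2"
      proof (rule norm_derivative_le)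
        show "holomorphic_map ?h" using Hb_add(1)[OF gH fH] by (simp add: Hb_def)
        show "norm (?h y) \<le> e/2" if "y \<in> cball x 1" for y using less[OF that] by (simp add: m1)
      qed
      moreover have "frechet_deriv ?h x = frechet_deriv g x - frechet_deriv f x"
      proof (rule blinfun_eqI)
        fix v
        have "blinfun_apply (frechet_deriv ?h x) v
            = blinfun_apply (frechet_deriv g x) v + (-1) *\<^sub>C blinfun_apply (frechet_deriv f x) v"
          using f by (simp only: Hb_add(2)[OF gH fH] Hb_scaleC(2) plus_blinfun.rep_eq DiffD1
              bounded_linear_Blinfun_apply bounded_linear_compose[OF bounded_linear_scaleC]
              blinfun.bounded_linear_right)
        then show "blinfun_apply (frechet_deriv ?h x) v
            = blinfun_apply (frechet_deriv g x - frechet_deriv f x) v"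
          by (simp add: m1 minus_blinfun.rep_eq)
      qed
      ultimately have "frechet_deriv g x \<in> ball (frechet_deriv f x) e"
        using e(1) by (simp add: dist_norm norm_minus_commute)
      then show ?thesis
        using e(2) frechet_deriv_Hb_in_LE[OF gH] gH unfolding bracket_def by blast
    qed
    then have "Hb_nhd f (cball x 1) (e/2) \<subseteq> Hb - bracket J" by blast
    then show ?thesis using e(1) by (intro exI[of _ "cball x 1"] exI[of _ "e/2"]) simp
  qed
  then show ?thesis
    by (auto simp: closedin_def topspace_Hb_topology openin_Hb_topology bracket_def)
qed

section \<open>Compactness\<close>

text \<open>Finite nets of the approximating compact sets show that the closure is totally bounded,
  and it is complete. This serves both for limits of difference quotients and for limits of
  truncated diagonal operators.\<close>

lemma compact_closure_approx:
  fixes S :: "'a::complete_space set"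
  assumes approx: "\<And>e. e > 0 \<Longrightarrow> \<exists>K. compact K \<and> (\<forall>x\<in>S. \<exists>y\<in>K. dist y x < e)"
  shows "compact (closure S)"
  unfolding compact_eq_totally_bounded
proof (intro conjI allI impI)
  show "complete (closure S)" by (simp add: complete_eq_closed)
  fix e :: real assume e: "0 < e"
  obtain K where K: "compact K" "\<And>x. x \<in> S \<Longrightarrow> \<exists>y\<in>K. dist y x < e/3"
    using approx[of "e/3"] e by auto
  obtain k where k: "finite k" "K \<subseteq> (\<Union>x\<in>k. ball x (e/3))"
    using K(1) e unfolding compact_eq_totally_bounded by (meson divide_pos_pos zero_less_numeral)
  have "closure S \<subseteq> (\<Union>x\<in>k. ball x e)"
  proof
    fix z assume "z \<in> closure S"
    then obtain x where x: "x \<in> S" "dist x z < e/3"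
      using e by (auto simp: closure_approachable dest: spec[of _ "e/3"])
    then obtain y where y: "y \<in> K" "dist y x < e/3" using K(2) by blast
    then obtain c where c: "c \<in> k" "dist c y < e/3" using k(2) by auto
    have "dist c z \<le> dist c y + dist y x + dist x z"
      using dist_triangle[of c z y] dist_triangle[of y z x] by linarith
    then show "z \<in> (\<Union>x\<in>k. ball x e)" using x y c by (intro UN_I[of c]) auto
  qed
  with k(1) show "\<exists>k. finite k \<and> closure S \<subseteq> (\<Union>x\<in>k. ball x e)" by blast
qed

text \<open>The difference quotients at \<open>x\<close> converge uniformly on the unit ball, so no Cauchy
  integral is needed here.\<close>

lemma compact_frechet_deriv:
  assumes f: "f \<in> Hk"
  shows "frechet_deriv f x \<in> compact_operators"
proof -
  have fH: "f \<in> Hb" using f by (simp add: Hk_def)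
  let ?D = "blinfun_apply (frechet_deriv f x)"
  have "compact (closure (?D ` cball 0 1))"
  proof (rule compact_closure_approx)
    fix e :: real assume e: "0 < e"
    obtain d where d: "d > 0"
      "\<And>y. norm (y - x) < d \<Longrightarrow> norm (f y - f x - ?D (y - x)) \<le> e/2 * norm (y - x)"
      using Hb_has_derivative[OF fH, of x] e unfolding has_derivative_at_alt
      by (meson half_gt_zero)
    \<comment> \<open>The derivative estimate holds strictly inside radius \<open>d\<close>, and
      increments up to length \<open>t\<close> are needed.\<close>
    define t where "t = d/2"
    have t: "0 < t" "t < d" using d(1) by (auto simp: t_def)
    \<comment> \<open>This affine map sends \<open>f (x + t *\<^sub>R v)\<close> to the difference
      quotient in direction \<open>v\<close>, so the compact set \<open>?K\<close> contains the
      quotients for all \<open>v\<close> in the unit ball at once.\<close>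
    let ?q = "\<lambda>z. (1/t) *\<^sub>R (z - f x)"
    let ?K = "?q ` closure (f ` cball x t)"
    have "compact ?K"
      using f by (intro compact_continuous_image continuous_intros) (simp add: Hk_def)
    moreover have "\<exists>y\<in>?K. dist y (?D v) < e" if v: "norm v \<le> 1" for v
    proof
      have tv: "norm (t *\<^sub>R v) \<le> t" using v t by simp
      then have "x + t *\<^sub>R v \<in> cball x t" by (simp add: dist_norm)
      then show "?q (f (x + t *\<^sub>R v)) \<in> ?K"
        by (intro imageI closure_subset[THEN subsetD])
      have "?q (f (x + t *\<^sub>R v)) - ?D v = (1/t) *\<^sub>R (f (x + t *\<^sub>R v) - f x - ?D (t *\<^sub>R v))"
        using t by (simp add: blinfun.scaleR_right algebra_simps)
      then have "norm (?q (f (x + t *\<^sub>R v)) - ?D v)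
          = norm (f (x + t *\<^sub>R v) - f x - ?D (t *\<^sub>R v)) / t"
        using t by simp
      also have "\<dots> \<le> (e/2 * norm (t *\<^sub>R v)) / t"
        using d(2)[of "x + t *\<^sub>R v"] le_less_trans[OF tv t(2)] t(1)
        by (intro divide_right_mono) auto
      also have "\<dots> = e/2 * norm v" using t by simp
      also have "\<dots> \<le> e/2 * 1" using v e by (intro mult_left_mono) auto
      finally show "dist (?q (f (x + t *\<^sub>R v))) (?D v) < e" using e by (simp add: dist_norm)
    qed
    ultimately show "\<exists>K. compact K \<and> (\<forall>x\<in>?D ` cball 0 1. \<exists>y\<in>K. dist y x < e)"
      by (intro exI[of _ ?K]) auto
  qed
  then show ?thesis
    using frechet_deriv_Hb_in_LE[OF fH] by (simp add: compact_operators_def)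
qed

lemma Hk_subset_bracket_compact_operators: "Hk \<subseteq> bracket compact_operators"
  using compact_frechet_deriv by (auto simp: bracket_def Hk_def)

section \<open>Coordinatewise squaring\<close>

text \<open>What \<open>c\<^sub>0\<close> and \<open>\<ell>\<^sub>p\<close> share for the
  counterexample: a submultiplicative norm for the coordinatewise product, and unit vectors in which
  every element expands. The product is only asserted to exist, since not every sequence is in the
  range of \<open>\<phi>\<close>; by \<open>inj\<close> it is unique.\<close>

locale coordinates =
  fixes \<phi> :: "'a::complex_banach \<Rightarrow> nat \<Rightarrow> complex" and e :: "nat \<Rightarrow> 'a"
  assumes inj: "inj \<phi>"
    and coord_add: "\<phi> (x + y) n = \<phi> x n + \<phi> y n"
    and coord_scaleC: "\<phi> (c *\<^sub>C x) n = c * \<phi> x n"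
    and coord_le: "cmod (\<phi> x n) \<le> norm x"
    and ex_mult: "\<exists>z. (\<forall>n. \<phi> z n = \<phi> x n * \<phi> y n) \<and> norm z \<le> norm x * norm y"
    and coord_unit: "\<phi> (e k) n = (if n = k then 1 else 0)"
    and norm_unit: "norm (e k) = 1"
    and expansion: "(\<lambda>N. \<Sum>k<N. \<phi> x k *\<^sub>C e k) \<longlonglongrightarrow> x"
begin

lemma coord_eqI: "(\<And>n. \<phi> x n = \<phi> y n) \<Longrightarrow> x = y"
  using injD[OF inj, of x y] by (simp add: fun_eq_iff)

lemma coord_scaleR: "\<phi> (r *\<^sub>R x) n = of_real r * \<phi> x n"
  by (simp add: scaleC_of_real[symmetric] coord_scaleC)

lemma coord_diff: "\<phi> (x - y) n = \<phi> x n - \<phi> y n"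
  using coord_add[of "x - y" y n] by simp

definition mult :: "'a \<Rightarrow> 'a \<Rightarrow> 'a" where
  "mult x y = (SOME z. (\<forall>n. \<phi> z n = \<phi> x n * \<phi> y n) \<and> norm z \<le> norm x * norm y)"

lemma coord_mult: "\<phi> (mult x y) n = \<phi> x n * \<phi> y n"
  and norm_mult_le: "norm (mult x y) \<le> norm x * norm y"
  using someI_ex[OF ex_mult[of x y]] by (simp_all add: mult_def)

lemma mult_commute: "mult x y = mult y x"
  by (rule coord_eqI) (simp add: coord_mult mult.commute)

lemma mult_scaleC: "mult x (c *\<^sub>C y) = c *\<^sub>C mult x y"
  by (rule coord_eqI) (simp add: coord_mult coord_scaleC)

lemma mult_unit: "mult (e k) x = \<phi> x k *\<^sub>C e k"
  by (rule coord_eqI) (simp add: coord_mult coord_scaleC coord_unit)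

lemma bounded_bilinear_mult: "bounded_bilinear mult"
proof (unfold_locales; (intro coord_eqI exI allI)?)
  \<comment> \<open>The constant of the bilinear bound is 1; the algebraic identities are checked
    coordinatewise.\<close>
  show "norm (mult x y) \<le> norm x * norm y * 1" for x y using norm_mult_le by simp
qed (simp_all add: coord_mult coord_add coord_scaleR algebra_simps)

lemma bounded_clinear_mult: "bounded_clinear (mult x)"
  using bounded_bilinear.bounded_linear_right[OF bounded_bilinear_mult, of x] mult_scaleC
  by (simp add: bounded_clinear_def)

text \<open>Replaces local compactness of finite-dimensional spans: \<open>K\<close> is a Minkowski
  sum of \<open>N\<close> compact discs, one for each unit vector.\<close>

lemma ex_compact_combinations:
  "\<exists>K. compact K \<and> (\<forall>c. (\<forall>k. cmod (c k) \<le> R) \<longrightarrow> (\<Sum>k<N. c k *\<^sub>C e k) \<in> K)"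
proof (induction N)
  case 0
  show ?case by (intro exI[of _ "{0}"]) simp
next
  case (Suc N)
  then obtain K where K: "compact K"
    "\<And>c. (\<And>k. cmod (c k) \<le> R) \<Longrightarrow> (\<Sum>k<N. c k *\<^sub>C e k) \<in> K" by blast
  have "bounded_linear (\<lambda>c::complex. c *\<^sub>C e N)"
    by (rule bounded_linear_intro[where K = "norm (e N)"])
      (simp_all add: scaleC_add_left norm_scaleC scaleC_of_real[symmetric] scaleC_scaleC scaleC_complex_def)
  then have "compact ((\<lambda>c::complex. c *\<^sub>C e N) ` cball 0 R)"
    by (intro compact_continuous_image linear_continuous_on compact_cball)
  note compact_sums[OF K(1) this]
  moreover have "(\<Sum>k<Suc N. c k *\<^sub>C e k) \<in> {x + y |x y. x \<in> K \<and> y \<in> (\<lambda>c. c *\<^sub>C e N) ` cball 0 R}"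
    if c: "\<forall>k. cmod (c k) \<le> R" for c
  proof -
    have "c N *\<^sub>C e N \<in> (\<lambda>c. c *\<^sub>C e N) ` cball 0 R" using c by (intro imageI) simp
    moreover have "(\<Sum>k<N. c k *\<^sub>C e k) \<in> K" using c by (intro K(2)) simp
    ultimately show ?thesis unfolding sum.lessThan_Suc by blast
  qed
  ultimately show ?case by blast
qed

text \<open>The diagonal operator is the norm limit of the diagonal operators of the truncations
  of \<open>x\<close>, which have finite rank.\<close>

lemma compact_mult: "compact (closure (mult x ` cball 0 1))"
proof (rule compact_closure_approx)
  interpret m: bounded_bilinear mult by (rule bounded_bilinear_mult)
  fix \<epsilon> :: real assume "0 < \<epsilon>"
  define s where "s N = (\<Sum>k<N. \<phi> x k *\<^sub>C e k)" for N
  have "s \<longlonglongrightarrow> x" using expansion by (simp add: s_def[abs_def])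
  then obtain N where N: "norm (s N - x) < \<epsilon>"
    using \<open>0 < \<epsilon>\<close> unfolding LIMSEQ_iff by blast
  \<comment> \<open>The radius \<open>norm x\<close> bounds the coefficients
    \<open>\<phi> x k * \<phi> v k\<close> for every \<open>v\<close> in the unit ball, so one
    \<open>K\<close> serves all of them.\<close>
  obtain K where K: "compact K"
    "\<And>c. (\<And>k. cmod (c k) \<le> norm x) \<Longrightarrow> (\<Sum>k<N. c k *\<^sub>C e k) \<in> K"
    using ex_compact_combinations[of "norm x" N] by blast
  have "\<exists>y\<in>K. dist y (mult x v) < \<epsilon>" if v: "norm v \<le> 1" for v
  proof
    \<comment> \<open>Multiplying by a unit vector extracts one coordinate, so the truncated
      operator yields a combination of \<open>N\<close> unit vectors.\<close>
    have "mult (s N) v = (\<Sum>k<N. mult v (\<phi> x k *\<^sub>C e k))"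
      by (simp add: s_def m.sum_left mult_commute[of v])
    also have "\<dots> = (\<Sum>k<N. (\<phi> x k * \<phi> v k) *\<^sub>C e k)"
      by (simp add: mult_scaleC mult_commute[of v] mult_unit scaleC_scaleC)
    also have "\<dots> \<in> K"
    proof (rule K(2))
      show "cmod (\<phi> x k * \<phi> v k) \<le> norm x" for k
        using mult_mono[OF coord_le[of x k] order_trans[OF coord_le[of v k] v]]
        by (simp add: norm_mult)
    qed
    finally show "mult (s N) v \<in> K" .
    have "dist (mult (s N) v) (mult x v) \<le> norm (s N - x) * norm v"
      using norm_mult_le[of "s N - x" v] by (simp add: dist_norm m.diff_left)
    also have "\<dots> \<le> norm (s N - x) * 1" using v by (intro mult_left_mono) auto
    finally show "dist (mult (s N) v) (mult x v) < \<epsilon>" using N by simp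
  qed
  with K(1) show "\<exists>K. compact K \<and> (\<forall>z\<in>mult x ` cball 0 1. \<exists>y\<in>K. dist y z < \<epsilon>)"
    by (intro exI[of _ K]) auto
qed

text \<open>The product rule for a commutative product. Writing the derivative as multiplication by
  \<open>x + x\<close> makes \<open>compact_mult\<close> and \<open>bounded_clinear_mult\<close>
  apply to it directly.\<close>

lemma square_has_derivative: "((\<lambda>x. mult x x) has_derivative mult (x + x)) (at x)"
proof -
  have "mult (x + x) = (\<lambda>v. mult x v + mult v x)"
    by (intro ext coord_eqI) (simp add: coord_mult coord_add algebra_simps)
  then show ?thesis
    using bounded_bilinear.FDERIV[OF bounded_bilinear_mult has_derivative_ident has_derivative_ident]
    by simp
qed

lemma square_in_bracket: "(\<lambda>x. mult x x) \<in> bracket compact_operators"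
proof -
  have "bounded ((\<lambda>x. mult x x) ` B)" if B: "bounded B" for B
  proof -
    obtain b where b: "\<And>x. x \<in> B \<Longrightarrow> norm x \<le> b" using B by (auto simp: bounded_iff)
    have "norm (mult x x) \<le> b * b" if "x \<in> B" for x
      using norm_mult_le[of x x] mult_mono[OF b b, OF that that] b[OF that] norm_ge_zero[of x]
      by linarith
    then show ?thesis by (auto simp: bounded_iff)
  qed
  then have "(\<lambda>x. mult x x) \<in> Hb"
    by (rule Hb_I[OF square_has_derivative bounded_clinear_mult])
  moreover have "frechet_deriv (\<lambda>x. mult x x) x \<in> compact_operators" for x
    using compact_mult bounded_clinear_mult
    by (simp add: compact_operators_def LE_def frechet_deriv_eq(2)[OF square_has_derivative])
  ultimately show ?thesis by (simp add: bracket_def)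
qed

lemma square_notin_Hk: "(\<lambda>x. mult x x) \<notin> Hk"
proof
  assume "(\<lambda>x. mult x x) \<in> Hk"
  then have "compact (closure ((\<lambda>x. mult x x) ` cball 0 1))" by (simp add: Hk_def)
  moreover have "e k \<in> closure ((\<lambda>x. mult x x) ` cball 0 1)" for k
  proof (rule closure_subset[THEN subsetD], rule image_eqI)
    show "e k = mult (e k) (e k)" by (simp add: mult_unit coord_unit)
  qed (simp add: norm_unit)
  ultimately obtain l r where "strict_mono r" "(e \<circ> r) \<longlonglongrightarrow> l"
    unfolding compact_def by metis
  then have "Cauchy (e \<circ> r)" by (intro LIMSEQ_imp_Cauchy)
  then obtain M where "\<And>m n. m \<ge> M \<Longrightarrow> n \<ge> M \<Longrightarrow> dist (e (r m)) (e (r n)) < 1"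
    unfolding Cauchy_def by (metis comp_apply zero_less_one)
  then have "norm (e (r M) - e (r (Suc M))) < 1" by (simp add: dist_norm)
  moreover have "r M \<noteq> r (Suc M)"
    using \<open>strict_mono r\<close> by (simp add: strict_mono_eq)
  \<comment> \<open>Coordinate \<open>r M\<close> of the difference is 1, although the norm of the
    difference is below 1.\<close>
  ultimately show False
    using coord_le[of "e (r M) - e (r (Suc M))" "r M"] by (simp add: coord_diff coord_unit)
qed

lemma Hk_psubset_bracket: "Hk \<subset> bracket (compact_operators :: ('a \<Rightarrow>\<^sub>L 'a) set)"
  using Hk_subset_bracket_compact_operators square_in_bracket square_notin_Hk by blast

end

section \<open>Coordinates on \<open>c\<^sub>0\<close> and \<open>\<ell>\<^sub>p\<close>\<close>

text \<open>Reduces the locale to statements about sequences alone. Surjectivity of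
  \<open>\<phi>\<close> onto \<open>S\<close> supplies the products and the unit vectors, and
  \<open>tail\<close> becomes convergence of the expansion.\<close>

lemma coordinates_if_identifies_with:
  fixes \<phi> :: "'a::complex_banach \<Rightarrow> nat \<Rightarrow> complex"
  assumes id: "identifies_with \<phi> S N"
    and le: "\<And>u n. u \<in> S \<Longrightarrow> cmod (u n) \<le> N u"
    and mult: "\<And>u v. u \<in> S \<Longrightarrow> v \<in> S \<Longrightarrow> (\<lambda>n. u n * v n) \<in> S \<and> N (\<lambda>n. u n * v n) \<le> N u * N v"
    and unit: "\<And>k. (\<lambda>n::nat. if n = k then 1 else 0) \<in> S \<and> N (\<lambda>n. if n = k then 1 else 0) = 1"
    and tail: "\<And>u. u \<in> S \<Longrightarrow> (\<lambda>M. N (\<lambda>n. if n < M then 0 else u n)) \<longlonglongrightarrow> 0"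
  shows "\<exists>e. coordinates \<phi> e"
proof -
  have bij: "bij_betw \<phi> UNIV S" and add: "\<And>x y n. \<phi> (x + y) n = \<phi> x n + \<phi> y n"
    and scale: "\<And>c x n. \<phi> (c *\<^sub>C x) n = c * \<phi> x n" and norm: "\<And>x. norm x = N (\<phi> x)"
    using id by (auto simp: identifies_with_def)
  have S: "\<phi> x \<in> S" for x using bij by (auto simp: bij_betw_def)
  have surj: "\<exists>x. \<phi> x = u" if "u \<in> S" for u using bij that by (auto simp: bij_betw_def)
  have "\<forall>k. \<exists>x. \<phi> x = (\<lambda>n. if n = k then 1 else 0)"
    using surj unit by blast
  then obtain e where e: "\<And>k. \<phi> (e k) = (\<lambda>n. if n = k then 1 else 0)"
    unfolding choice_iff by blast
  have zero: "\<phi> 0 n = 0" for n using add[of 0 0 n] by simp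
  \<comment> \<open>The partial sums of the expansion are the truncations of \<open>x\<close>, so
    their errors are the tails.\<close>
  have sum: "\<phi> (\<Sum>k<M. \<phi> x k *\<^sub>C e k) n = (if n < M then \<phi> x n else 0)" for x M n
    by (induction M) (auto simp: zero add scale e less_Suc_eq)
  have diff: "\<phi> (y - x) n = \<phi> y n - \<phi> x n" for x y n
    using add[of "y - x" x n] by simp
  have "coordinates \<phi> e"
  proof
    show "inj \<phi>" using bij by (auto simp: bij_betw_def)
    show "cmod (\<phi> x n) \<le> norm x" for x n using le[OF S] by (simp add: norm)
    show "\<exists>z. (\<forall>n. \<phi> z n = \<phi> x n * \<phi> y n) \<and> norm z \<le> norm x * norm y" for x y
    proof -
      obtain z where z: "\<phi> z = (\<lambda>n. \<phi> x n * \<phi> y n)" using surj mult[OF S S] by blast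
      then show ?thesis using mult[OF S S, of x y] by (intro exI[of _ z]) (simp add: norm)
    qed
    show "norm (e k) = 1" for k using unit by (simp add: norm e)
    show "(\<lambda>M. \<Sum>k<M. \<phi> x k *\<^sub>C e k) \<longlonglongrightarrow> x" for x
    proof -
      have "\<phi> (x - (\<Sum>k<M. \<phi> x k *\<^sub>C e k)) = (\<lambda>n. if n < M then 0 else \<phi> x n)" for M
        by (rule ext) (simp add: diff sum)
      then have "norm (x - (\<Sum>k<M. \<phi> x k *\<^sub>C e k)) = N (\<lambda>n. if n < M then 0 else \<phi> x n)" for M
        by (simp add: norm)
      then have "(\<lambda>M. norm (x - (\<Sum>k<M. \<phi> x k *\<^sub>C e k))) \<longlonglongrightarrow> 0"
        using tail[OF S] by simp
      then show ?thesis
        by (subst tendsto_dist_iff) (simp add: dist_norm norm_minus_commute)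
    qed
  qed (simp_all add: add scale e)
  then show ?thesis by blast
qed

text \<open>Convergence to zero makes a sequence bounded, so that the supremum dominates every
  entry, and makes its tails small in the supremum norm.\<close>

lemma coordinates_c0:
  fixes \<phi> :: "'a::complex_banach \<Rightarrow> nat \<Rightarrow> complex"
  assumes "identifies_with \<phi> c0_set c0_norm"
  shows "\<exists>e. coordinates \<phi> e"
  using assms
proof (rule coordinates_if_identifies_with)
  have le: "cmod (u n) \<le> c0_norm u" if "u \<in> c0_set" for u n
  proof -
    have "Bseq u" using that by (auto simp: c0_set_def intro: convergent_imp_Bseq convergentI)
    then have "bdd_above (range (\<lambda>n. cmod (u n)))" by (auto simp: Bseq_def intro: bdd_aboveI2)
    then show ?thesis unfolding c0_norm_def by (rule cSUP_upper[rotated]) simp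
  qed
  then show "cmod (u n) \<le> c0_norm u" if "u \<in> c0_set" for u n using that .
  have bound: "c0_norm u \<le> b" if "\<And>n. cmod (u n) \<le> b" for u b
    unfolding c0_norm_def using that by (intro cSUP_least) auto
  fix u v :: "nat \<Rightarrow> complex" assume u: "u \<in> c0_set"
  show "(\<lambda>M. c0_norm (\<lambda>n. if n < M then 0 else u n)) \<longlonglongrightarrow> 0"
  proof (rule LIMSEQ_I)
    fix r :: real assume r: "0 < r"
    \<comment> \<open>With \<open>r/2\<close> the bound survives the supremum, which preserves only
      the weak inequality.\<close>
    then obtain M0 where M0: "\<And>n. n \<ge> M0 \<Longrightarrow> cmod (u n) < r/2"
      using u half_gt_zero[OF r] unfolding c0_set_def LIMSEQ_iff by fastforce
    have "norm (c0_norm (\<lambda>n. if n < M then 0 else u n) - 0) < r" if M: "M \<ge> M0" for M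
    proof -
      let ?t = "\<lambda>n. if n < M then 0 else u n"
      \<comment> \<open>Membership of the tail in \<open>c0_set\<close> gives access to
        \<open>le\<close>, hence to nonnegativity of its norm.\<close>
      have "eventually (\<lambda>n. ?t n = u n) sequentially"
        unfolding eventually_sequentially by (intro exI[of _ M]) auto
      then have "?t \<in> c0_set" using u by (simp add: c0_set_def tendsto_cong)
      then have "0 \<le> c0_norm ?t" using le[of ?t 0] norm_ge_zero order_trans by blast
      moreover have "c0_norm ?t \<le> r/2"
        using r M0 M by (intro bound) (auto intro: less_imp_le)
      ultimately show ?thesis using r by simp
    qed
    then show "\<exists>M0. \<forall>M\<ge>M0. norm (c0_norm (\<lambda>n. if n < M then 0 else u n) - 0) < r" by blast
  qed
  assume v: "v \<in> c0_set"
  have "(\<lambda>n. u n * v n) \<in> c0_set"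
    using tendsto_mult[of u 0 sequentially v 0] u v by (simp add: c0_set_def)
  moreover have "c0_norm (\<lambda>n. u n * v n) \<le> c0_norm u * c0_norm v"
  proof (rule bound)
    have "0 \<le> c0_norm u" using le[OF u, of 0] norm_ge_zero order_trans by blast
    then show "cmod (u n * v n) \<le> c0_norm u * c0_norm v" for n
      by (simp add: norm_mult mult_mono le u v)
  qed
  ultimately show "(\<lambda>n. u n * v n) \<in> c0_set \<and> c0_norm (\<lambda>n. u n * v n) \<le> c0_norm u * c0_norm v" ..
next
  fix k
  let ?e = "\<lambda>n::nat. if n = k then 1 else 0 :: complex"
  have "eventually (\<lambda>n. ?e n = 0) sequentially"
    unfolding eventually_sequentially by (intro exI[of _ "Suc k"]) auto
  then have "?e \<in> c0_set" by (simp add: c0_set_def tendsto_eventually)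
  moreover have "c0_norm ?e = 1"
    unfolding c0_norm_def by (rule cSup_eq_maximum) (auto intro: image_eqI[of _ _ k])
  ultimately show "?e \<in> c0_set \<and> c0_norm ?e = 1" ..
qed

text \<open>The estimates are made for the power sum \<open>A\<close> and carried to the norm by the
  monotone and multiplicative power \<open>1/p\<close>.\<close>

lemma coordinates_lp:
  fixes \<phi> :: "'a::complex_banach \<Rightarrow> nat \<Rightarrow> complex"
  assumes p: "0 < p" and "identifies_with \<phi> (lp_set p) (lp_norm p)"
  shows "\<exists>e. coordinates \<phi> e"
  using assms(2)
proof (rule coordinates_if_identifies_with)
  define A where "A u = (\<Sum>n. cmod (u n) powr p)" for u
  have norm: "lp_norm p u = A u powr (1/p)" for u by (simp add: lp_norm_def A_def)
  have le: "cmod (u n) powr p \<le> A u" if "u \<in> lp_set p" for u n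
    using sum_le_suminf[of "\<lambda>n. cmod (u n) powr p" "{n}"] that by (simp add: lp_set_def A_def)
  have A0: "0 \<le> A u" if "u \<in> lp_set p" for u
    using that by (simp add: A_def lp_set_def suminf_nonneg)
  show "cmod (u n) \<le> lp_norm p u" if "u \<in> lp_set p" for u n
    using powr_mono2[OF _ _ le[OF that, of n], of "1/p"] p by (simp add: norm powr_powr)
  fix u v :: "nat \<Rightarrow> complex" assume u: "u \<in> lp_set p"
  show "(\<lambda>M. lp_norm p (\<lambda>n. if n < M then 0 else u n)) \<longlonglongrightarrow> 0"
  proof -
    have su: "summable (\<lambda>n. cmod (u n) powr p)" using u by (simp add: lp_set_def)
    have tail: "A (\<lambda>n. if n < M then 0 else u n) = A u - (\<Sum>n<M. cmod (u n) powr p)"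
      and tail0: "0 \<le> A (\<lambda>n. if n < M then 0 else u n)" for M
    proof -
      \<comment> \<open>The tail is the whole series minus a finite head, so its power sum is the
        remainder of a convergent series.\<close>
      have "(\<lambda>n. cmod (u n) powr p - (if n < M then cmod (u n) powr p else 0)) sums
          (A u - (\<Sum>n<M. cmod (u n) powr p))"
        unfolding A_def using sums_If_finite_set[of "{..<M}" "\<lambda>n. cmod (u n) powr p"]
        by (intro sums_diff summable_sums su) simp
      moreover have "(\<lambda>n. cmod (u n) powr p - (if n < M then cmod (u n) powr p else 0))
          = (\<lambda>n. cmod (if n < M then 0 else u n) powr p)" by auto
      ultimately have *: "(\<lambda>n. cmod (if n < M then 0 else u n) powr p) sums
          (A u - (\<Sum>n<M. cmod (u n) powr p))" by simp
      then show "A (\<lambda>n. if n < M then 0 else u n) = A u - (\<Sum>n<M. cmod (u n) powr p)"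
        by (simp add: A_def sums_iff)
      show "0 \<le> A (\<lambda>n. if n < M then 0 else u n)"
        using * by (intro A0) (simp add: lp_set_def sums_iff)
    qed
    have "(\<lambda>M. A u - (\<Sum>n<M. cmod (u n) powr p)) \<longlonglongrightarrow> A u - A u"
      unfolding A_def by (intro tendsto_diff tendsto_const summable_LIMSEQ su)
    then have "(\<lambda>M. A (\<lambda>n. if n < M then 0 else u n)) \<longlonglongrightarrow> 0" by (simp add: tail)
    then show ?thesis
      \<comment> \<open>Taking the power \<open>1/p\<close> preserves the limit \<open>0\<close>
        because the exponent is positive and the remainders are nonnegative by
        \<open>tail0\<close>.\<close>
      unfolding norm using p tail0
      by (intro tendsto_zero_powrI[where b = "1/p"] tendsto_const) (auto intro: always_eventually)
  qed
  assume v: "v \<in> lp_set p"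
  \<comment> \<open>Each entry of \<open>u\<close> is dominated by the full power sum; summing over
    \<open>n\<close> gives both summability of the product and
    \<open>A (\<lambda>n. u n * v n) \<le> A u * A v\<close>.\<close>
  have uv: "cmod (u n * v n) powr p \<le> A u * cmod (v n) powr p" for n
    using le[OF u, of n] by (simp add: norm_mult powr_mult mult_right_mono)
  have sv: "summable (\<lambda>n. A u * cmod (v n) powr p)"
    using v by (simp add: lp_set_def summable_mult)
  have suv: "summable (\<lambda>n. cmod (u n * v n) powr p)"
    by (rule summable_comparison_test'[OF sv, of 0]) (use uv in simp)
  have "A (\<lambda>n. u n * v n) \<le> A u * A v"
    unfolding A_def[of "\<lambda>n. u n * v n"] A_def[of v]
    using suminf_le[OF uv suv sv] v by (simp add: suminf_mult lp_set_def)
  then have "lp_norm p (\<lambda>n. u n * v n) \<le> lp_norm p u * lp_norm p v"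
    using powr_mono2[of "1/p" "A (\<lambda>n. u n * v n)" "A u * A v"] p A0[OF u] A0[OF v]
      A0[of "\<lambda>n. u n * v n"] suv
    by (simp add: norm powr_mult lp_set_def)
  then show "(\<lambda>n. u n * v n) \<in> lp_set p \<and> lp_norm p (\<lambda>n. u n * v n) \<le> lp_norm p u * lp_norm p v"
    using suv by (simp add: lp_set_def)
next
  fix k
  let ?e = "\<lambda>n::nat. if n = k then 1 else 0 :: complex"
  have "(\<lambda>n. cmod (?e n) powr p) = (\<lambda>n. if n = k then 1 else 0)" by auto
  moreover have "(\<lambda>n. if n = k then 1 else 0) sums (1::real)"
    using sums_single[of k "\<lambda>_. 1::real"] by simp
  ultimately have "(\<lambda>n. cmod (?e n) powr p) sums 1" by simp
  then show "?e \<in> lp_set p \<and> lp_norm p ?e = 1"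
    by (simp add: lp_set_def lp_norm_def sums_iff)
qed

theorem proposition3p3:
  shows "(\<forall>J :: ('a::complex_banach \<Rightarrow>\<^sub>L 'a) set.
            nontrivial_closed_operator_ideal J \<longrightarrow>
              Hb_ideal (bracket J) \<and> bracket J \<noteq> Hb \<and> closedin Hb_topology (bracket J) \<and>
              blinfun_apply ` J \<subseteq> bracket J)
       \<and> (Hk :: ('a \<Rightarrow> 'a) set) \<subseteq> bracket compact_operators
       \<and> (is_c0 TYPE('a) \<or> (\<exists>p\<ge>1. is_lp p TYPE('a)) \<longrightarrow>
            (Hk :: ('a \<Rightarrow> 'a) set) \<subset> bracket compact_operators)"
proof (intro conjI allI impI)
  fix J :: "('a \<Rightarrow>\<^sub>L 'a) set"
  assume "nontrivial_closed_operator_ideal J"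
  then have J: "operator_ideal J" "J \<noteq> LE" "closedin (top_of_set LE) J"
    by (auto simp: nontrivial_closed_operator_ideal_def)
  show "Hb_ideal (bracket J)" by (rule Hb_ideal_bracket[OF J(1)])
  show "bracket J \<noteq> Hb" by (rule bracket_neq_Hb[OF J(1,2)])
  show "closedin Hb_topology (bracket J)" by (rule closedin_bracket[OF J(3)])
  show "blinfun_apply ` J \<subseteq> bracket J" by (rule operator_ideal_image_subset_bracket[OF J(1)])
next
  show "(Hk :: ('a \<Rightarrow> 'a) set) \<subseteq> bracket compact_operators"
    by (rule Hk_subset_bracket_compact_operators)
next
  assume "is_c0 TYPE('a) \<or> (\<exists>p\<ge>1. is_lp p TYPE('a))"
  \<comment> \<open>Both kinds of sequence space enter the strict inclusion only through the locale
    \<open>coordinates\<close>.\<close>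
  then have "\<exists>(\<phi> :: 'a \<Rightarrow> nat \<Rightarrow> complex) e. coordinates \<phi> e"
  proof
    assume "is_c0 TYPE('a)"
    then show ?thesis using coordinates_c0 unfolding is_c0_def by blast
  next
    assume "\<exists>p\<ge>1. is_lp p TYPE('a)"
    then obtain p and \<phi> :: "'a \<Rightarrow> nat \<Rightarrow> complex"
      where "p \<ge> 1" "identifies_with \<phi> (lp_set p) (lp_norm p)" by (auto simp: is_lp_def)
    then show ?thesis using coordinates_lp[of p \<phi>] by auto
  qed
  then show "(Hk :: ('a \<Rightarrow> 'a) set) \<subset> bracket compact_operators"
    using coordinates.Hk_psubset_bracket by blast
qed

end
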